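(* Let $\mathcal H$ be a real Hilbert space and let $f\in\Gamma_0(\mathcal H)$. Then the following are equivalent: (i) $f$ is almost strictly convex. (ii) The Fenchel conjugate $f^*$ is almost differentiable.
   Context: $\Gamma_0(\mathcal H)$ is the set of proper, lower semicontinuous, convex functions $f:\mathcal H\to\left]-\infty,+\infty\right]$. The subdifferential is $\partial f(x)=\{v\in\mathcal H : f(y)\ge f(x)+\langle v,y-x\rangle\ \forall y\in\mathcal H\}$, $\operatorname{dom}\partial f=\{x:\partial f(x)\neq\varnothing\}$, and the Fenchel conjugate is $f^*(v)=\sup_{x\in\mathcal H}(\langle x,v\rangle-f(x))$. A function $f\in\Gamma_0(\mathcal H)$ is almost strictly convex if it is strictly convex along every line segment contained in $\operatorname{dom}\partial f$. A function $g\in\Gamma_0(\mathcal H)$ is almost differentiable if for every $x\in\mathcal H$ the set $\partial g(x)$ is either a singleton or empty (no assumption that $\operatorname{int}\operatorname{dom}g\neq\varnothing$ is made). *)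

theory Defs
  imports "HOL-Analysis.Analysis"
begin

definition proper_fun :: "('a \<Rightarrow> ereal) \<Rightarrow> bool" where
  "proper_fun f \<longleftrightarrow> (\<forall>x. f x \<noteq> -\<infinity>) \<and> (\<exists>x. f x \<noteq> \<infinity>)"

definition lower_semicontinuous :: "('a::topological_space \<Rightarrow> ereal) \<Rightarrow> bool" where
  "lower_semicontinuous f \<longleftrightarrow> (\<forall>x. f x \<le> Liminf (nhds x) f)"

text \<open>
  The library's \<^const>\<open>convex_on\<close> is for real-valued functions only. The weights below are strictly
  positive and the functions considered never take the value \<open>-\<infinity>\<close>, so that neither
  \<open>0 * \<infinity>\<close> nor \<open>\<infinity> - \<infinity>\<close> arises.
\<close>

definition convex_fun :: "('a::real_vector \<Rightarrow> ereal) \<Rightarrow> bool" where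
  "convex_fun f \<longleftrightarrow>
     (\<forall>x y t. 0 < t \<and> t < 1 \<longrightarrow>
        f ((1 - t) *\<^sub>R x + t *\<^sub>R y) \<le> ereal (1 - t) * f x + ereal t * f y)"

definition strictly_convex_fun_on :: "'a::real_vector set \<Rightarrow> ('a \<Rightarrow> ereal) \<Rightarrow> bool" where
  "strictly_convex_fun_on S f \<longleftrightarrow>
     (\<forall>x\<in>S. \<forall>y\<in>S. \<forall>t. x \<noteq> y \<and> 0 < t \<and> t < 1 \<longrightarrow>
        f ((1 - t) *\<^sub>R x + t *\<^sub>R y) < ereal (1 - t) * f x + ereal t * f y)"

definition Gamma0 :: "('a::real_inner \<Rightarrow> ereal) set" where
  "Gamma0 = {f. proper_fun f \<and> lower_semicontinuous f \<and> convex_fun f}"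

definition subdifferential :: "('a::real_inner \<Rightarrow> ereal) \<Rightarrow> 'a \<Rightarrow> 'a set" where
  "subdifferential f x = {v. \<forall>y. f y \<ge> f x + ereal (v \<bullet> (y - x))}"

definition dom_subdifferential :: "('a::real_inner \<Rightarrow> ereal) \<Rightarrow> 'a set" where
  "dom_subdifferential f = {x. subdifferential f x \<noteq> {}}"

definition fenchel_conjugate :: "('a::real_inner \<Rightarrow> ereal) \<Rightarrow> 'a \<Rightarrow> ereal" where
  "fenchel_conjugate f v = (SUP x. ereal (x \<bullet> v) - f x)"

definition almost_strictly_convex :: "('a::real_inner \<Rightarrow> ereal) \<Rightarrow> bool" where
  "almost_strictly_convex f \<longleftrightarrow>
     f \<in> Gamma0 \<and>
     (\<forall>a b. closed_segment a b \<subseteq> dom_subdifferential f \<longrightarrow>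
        strictly_convex_fun_on (closed_segment a b) f)"

definition almost_differentiable :: "('a::real_inner \<Rightarrow> ereal) \<Rightarrow> bool" where
  "almost_differentiable g \<longleftrightarrow>
     g \<in> Gamma0 \<and>
     (\<forall>x. (\<exists>v. subdifferential g x = {v}) \<or> subdifferential g x = {})"

end

theory Submission
  imports Defs
begin

text \<open>
  If \<open>v\<close> is a subgradient of \<open>f\<close> at two points \<open>x \<noteq> y\<close>, then \<open>f\<close> is affine on the segment
  between them and \<open>v\<close> is a subgradient along all of it; conversely, if strict convexity fails at
  an interior point \<open>z\<close>, then every subgradient at \<open>z\<close> is one at both ends. The passage to the
  conjugate needs \<open>v \<in> \<partial>f x \<longleftrightarrow> x \<in> \<partial>f* v\<close>. The Fenchel--Moreau theorem is avoided for the
  direction from right to left: minimising \<open>f + |\<cdot> - (x + v)|\<^sup>2/2\<close> gives a point \<open>p\<close> with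
  \<open>x + v - p \<in> \<partial>f p\<close>, and monotonicity of \<open>\<partial>f*\<close> forces \<open>p = x\<close>.
\<close>

section \<open>Finite values, convexity, semicontinuity and subgradients over the extended
  reals\<close>

lemma Gamma0_not_MInf: "f \<in> Gamma0 \<Longrightarrow> f x \<noteq> - \<infinity>"
  by (auto simp: Gamma0_def proper_fun_def)

lemma Gamma0_finite_point:
  assumes "f \<in> Gamma0"
  obtains x r where "f x = ereal r"
proof -
  from assms obtain x where "f x \<noteq> \<infinity>" "f x \<noteq> - \<infinity>"
    by (auto simp: Gamma0_def proper_fun_def)
  then show ?thesis using that by (cases "f x") auto
qed

lemma Gamma0_convexD:
  assumes "f \<in> Gamma0" "f x = ereal a" "f y = ereal b" "0 < t" "t < 1"
  shows "f ((1 - t) *\<^sub>R x + t *\<^sub>R y) \<le> ereal ((1 - t) * a + t * b)"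
  using assms(1,4,5) by (force simp: Gamma0_def convex_fun_def assms(2,3)[symmetric]
      simp flip: plus_ereal.simps times_ereal.simps)

lemma Gamma0_lscD:
  assumes "f \<in> Gamma0" "c < f x"
  shows "\<forall>\<^sub>F y in nhds x. c < f y"
  using assms by (auto simp: Gamma0_def lower_semicontinuous_def le_Liminf_iff)

text \<open>Properness supplies a point with a finite value; the subgradient inequality there rules
  out \<open>f x = \<infinity>\<close>.\<close>

lemma subdifferential_finite:
  assumes "f \<in> Gamma0" "v \<in> subdifferential f x"
  obtains r where "f x = ereal r"
proof -
  obtain z b where zb: "f z = ereal b" using Gamma0_finite_point[OF assms(1)] .
  with assms(2) have "f x + ereal (v \<bullet> (z - x)) \<le> ereal b"
    unfolding subdifferential_def by (metis (mono_tags, lifting) mem_Collect_eq)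
  then show ?thesis
    using that Gamma0_not_MInf[OF assms(1), of x] by (cases "f x") auto
qed

lemma subdifferentialD:
  "v \<in> subdifferential f x \<Longrightarrow> f x = ereal a \<Longrightarrow> f y = ereal b \<Longrightarrow> a + v \<bullet> (y - x) \<le> b"
  unfolding subdifferential_def
  by (metis (mono_tags, lifting) ereal_less_eq(3) mem_Collect_eq plus_ereal.simps(1))

lemma subdifferentialI:
  assumes "f \<in> Gamma0" "f x = ereal a"
    and "\<And>y b. f y = ereal b \<Longrightarrow> a + v \<bullet> (y - x) \<le> b"
  shows "v \<in> subdifferential f x"
proof -
  have "ereal a + ereal (v \<bullet> (y - x)) \<le> f y" for y
    using assms(3)[of y] Gamma0_not_MInf[OF assms(1), of y] by (cases "f y") auto
  then show ?thesis by (simp add: subdifferential_def assms(2))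
qed

section \<open>Existence of proximal points\<close>

lemma Gamma0_cone_minorant:
  assumes f: "f \<in> Gamma0"
  obtains x\<^sub>0 c d where "d > 0" "\<And>y. ereal (c - norm (y - x\<^sub>0) / d) \<le> f y"
proof -
  obtain x\<^sub>0 r where r: "f x\<^sub>0 = ereal r" using Gamma0_finite_point[OF f] .
  have "\<forall>\<^sub>F y in nhds x\<^sub>0. ereal (r - 1) < f y"
    by (rule Gamma0_lscD[OF f]) (simp add: r)
  then obtain e where e: "e > 0" "\<And>y. dist y x\<^sub>0 < e \<Longrightarrow> ereal (r - 1) < f y"
    unfolding eventually_nhds_metric by blast
  \<comment> \<open>Halving \<open>e\<close> gives the bound on the whole closed ball of radius
    \<open>d\<close>, boundary included.\<close>
  define d where "d = e / 2"
  have d: "d > 0" "\<And>y. norm (y - x\<^sub>0) \<le> d \<Longrightarrow> ereal (r - 1) < f y"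
    using e by (auto simp: d_def dist_norm)
  have "ereal ((r - 1) - norm (y - x\<^sub>0) / d) \<le> f y" for y
  proof (cases "norm (y - x\<^sub>0) \<le> d")
    case True
    have "ereal ((r - 1) - norm (y - x\<^sub>0) / d) \<le> ereal (r - 1)" using d(1) by simp
    also have "\<dots> \<le> f y" using d(2)[OF True] by simp
    finally show ?thesis .
  next
    case False
    show ?thesis
    proof (cases "f y")
      case (real b)
      \<comment> \<open>With this \<open>t\<close> the point on the segment from
        \<open>x\<^sub>0\<close> to \<open>y\<close> has distance exactly \<open>d\<close> from
        \<open>x\<^sub>0\<close>. There \<open>f\<close> exceeds \<open>r - 1\<close>, so convexity
        limits the drop \<open>r - b\<close> to less than \<open>1 / t\<close>.\<close>
      define t where "t = d / norm (y - x\<^sub>0)"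
      have t: "0 < t" "t < 1" using False d(1) by (auto simp: t_def divide_simps)
      have "(1 - t) *\<^sub>R x\<^sub>0 + t *\<^sub>R y - x\<^sub>0 = t *\<^sub>R (y - x\<^sub>0)" by (simp add: algebra_simps)
      then have "norm ((1 - t) *\<^sub>R x\<^sub>0 + t *\<^sub>R y - x\<^sub>0) \<le> d" using t False d(1) by (simp add: t_def)
      from d(2)[OF this] have "ereal (r - 1) < f ((1 - t) *\<^sub>R x\<^sub>0 + t *\<^sub>R y)" .
      also have "\<dots> \<le> ereal ((1 - t) * r + t * b)" by (rule Gamma0_convexD[OF f r real t])
      finally have "t * (r - b) < 1" by (simp add: algebra_simps)
      then have "r - b < 1 / t" using t by (simp add: field_simps)
      also have "1 / t = norm (y - x\<^sub>0) / d" by (simp add: t_def)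
      finally show ?thesis using real by simp
    qed (use Gamma0_not_MInf[OF f, of y] in auto)
  qed
  then show ?thesis using that d(1) by blast
qed

text \<open>The parallelogram law for \<open>a - u\<close> and \<open>b - u\<close>. The weights
  stay unsimplified to match \<open>Gamma0_convexD\<close> at \<open>t = 1/2\<close>.\<close>

lemma norm_midpoint_sq:
  fixes a b u :: "'a::real_inner"
  shows "(norm ((1 - 1/2) *\<^sub>R a + (1/2) *\<^sub>R b - u))\<^sup>2
    = (norm (a - u))\<^sup>2 / 2 + (norm (b - u))\<^sup>2 / 2 - (norm (a - b))\<^sup>2 / 4"
  unfolding power2_norm_eq_inner
  by (simp add: inner_simps inner_commute field_simps)

text \<open>Direct method: the quadratic term makes every minimising sequence Cauchy, completeness
  gives a limit, and lower semicontinuity makes the limit a minimiser.\<close>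

lemma Gamma0_prox_exists:
  fixes f :: "'a::{real_inner, complete_space} \<Rightarrow> ereal"
  assumes f: "f \<in> Gamma0"
  obtains p q where "f p = ereal q"
    "\<And>y b. f y = ereal b \<Longrightarrow> q + (norm (p - u))\<^sup>2 / 2 \<le> b + (norm (y - u))\<^sup>2 / 2"
proof -
  define V where "V = {b + (norm (y - u))\<^sup>2 / 2 | y b. f y = ereal b}"
  define m where "m = Inf V"
  have V_ne: "V \<noteq> {}" using Gamma0_finite_point[OF f] unfolding V_def by blast
  obtain x\<^sub>0 c d where d: "d > 0" "\<And>y. ereal (c - norm (y - x\<^sub>0) / d) \<le> f y"
    using Gamma0_cone_minorant[OF f] by metis
  \<comment> \<open>The cone minorant decreases only linearly. With \<open>s = norm (y - u)\<close>,
    the square of \<open>s - 1 / d\<close> being nonnegative shows that \<open>s\<^sup>2 / 2\<close>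
    absorbs the loss \<open>s / d\<close> up to the constant
    \<open>1 / (2 * d\<^sup>2)\<close>.\<close>
  have "c - norm (u - x\<^sub>0) / d - 1 / (2 * d\<^sup>2) \<le> w" if "w \<in> V" for w
  proof -
    from that obtain y b where yb: "f y = ereal b" "w = b + (norm (y - u))\<^sup>2 / 2"
      unfolding V_def by blast
    have "norm (y - x\<^sub>0) \<le> norm (y - u) + norm (u - x\<^sub>0)"
      using norm_triangle_ineq[of "y - u" "u - x\<^sub>0"] by simp
    then have "norm (y - x\<^sub>0) / d \<le> norm (y - u) / d + norm (u - x\<^sub>0) / d"
      using d(1) by (simp add: divide_simps)
    moreover have "c - norm (y - x\<^sub>0) / d \<le> b" using d(2)[of y] yb by simp
    moreover have "norm (y - u) / d \<le> (norm (y - u))\<^sup>2 / 2 + 1 / (2 * d\<^sup>2)"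
      using zero_le_power2[of "norm (y - u) - 1 / d"]
      by (simp add: power2_diff power_divide)
    ultimately show ?thesis using yb(2) by linarith
  qed
  then have bdd: "bdd_below V" by (rule bdd_belowI)
  have m_le: "m \<le> b + (norm (y - u))\<^sup>2 / 2" if "f y = ereal b" for y b
    unfolding m_def by (rule cInf_lower[OF _ bdd]) (use that V_def in blast)
  have "\<exists>y b. f y = ereal b \<and> b + (norm (y - u))\<^sup>2 / 2 < m + 1 / Suc n" for n
  proof -
    have "\<exists>w\<in>V. w < m + 1 / Suc n"
      by (rule cInf_lessD[OF V_ne]) (simp add: m_def)
    then show ?thesis unfolding V_def by blast
  qed
  then obtain y b where y: "\<And>n. f (y n) = ereal (b n)"
      "\<And>n. b n + (norm (y n - u))\<^sup>2 / 2 < m + 1 / Suc n"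
    by metis
  \<comment> \<open>The midpoint has objective value at least \<open>m\<close>, both ends have less
    than \<open>m + 1 / Suc n\<close>, and the parallelogram law gains an eighth of the squared
    distance.\<close>
  have gap: "(norm (y i - y j))\<^sup>2 < 8 / Suc n" if "n \<le> i" "n \<le> j" for i j n
  proof -
    let ?z = "(1 - 1/2) *\<^sub>R y i + (1/2) *\<^sub>R y j"
    have le: "f ?z \<le> ereal ((1 - 1/2) * b i + 1/2 * b j)"
      by (rule Gamma0_convexD[OF f y(1) y(1)]) auto
    then obtain a where a: "f ?z = ereal a"
      using Gamma0_not_MInf[OF f, of ?z] by (cases "f ?z") auto
    have "a \<le> b i / 2 + b j / 2" using le a by simp
    moreover have "m \<le> a + ((norm (y i - u))\<^sup>2 / 2 + (norm (y j - u))\<^sup>2 / 2 - (norm (y i - y j))\<^sup>2 / 4) / 2"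
      using m_le[OF a] by (simp only: norm_midpoint_sq)
    moreover have "1 / Suc i \<le> 1 / Suc n" "1 / Suc j \<le> 1 / Suc n"
      using that by (auto simp: divide_simps)
    ultimately have "(norm (y i - y j))\<^sup>2 < 8 * (1 / Suc n)"
      using y(2)[of i] y(2)[of j] by argo
    then show ?thesis by simp
  qed
  have "Cauchy y"
  proof (rule metric_CauchyI)
    fix e :: real assume e: "e > 0"
    then obtain n where n: "8 / e\<^sup>2 < Suc n"
      using reals_Archimedean2 less_trans by (metis lessI of_nat_less_iff)
    have "dist (y i) (y j) < e" if "n \<le> i" "n \<le> j" for i j
    proof (rule power2_less_imp_less)
      have "8 / Suc n < e\<^sup>2" using n e by (simp add: field_simps)
      then show "(dist (y i) (y j))\<^sup>2 < e\<^sup>2" using gap[OF that] by (simp add: dist_norm)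
    qed (use e in auto)
    then show "\<exists>M. \<forall>m\<ge>M. \<forall>n\<ge>M. dist (y m) (y n) < e" by blast
  qed
  then obtain p where p: "y \<longlonglongrightarrow> p" using Cauchy_convergent convergent_def by blast
  \<comment> \<open>A priori \<open>f p\<close> may be infinite, so semicontinuity is applied to
    each real \<open>c\<close> below \<open>f p\<close>, and the bounds on \<open>b n\<close> are
    passed to the limit.\<close>
  have "c \<le> m - (norm (p - u))\<^sup>2 / 2" if "ereal c < f p" for c
  proof (rule tendsto_lowerbound)
    show "(\<lambda>n. m + 1 / Suc n - (norm (y n - u))\<^sup>2 / 2) \<longlonglongrightarrow> m - (norm (p - u))\<^sup>2 / 2"
      using tendsto_diff[OF tendsto_add[OF tendsto_const LIMSEQ_inverse_real_of_nat]
          tendsto_divide[OF tendsto_power[OF tendsto_norm[OF tendsto_diff[OF p tendsto_const]]] tendsto_const],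
          of 2 m u 2]
      by (simp add: field_simps)
    have "\<forall>\<^sub>F n in sequentially. ereal c < f (y n)"
      using Gamma0_lscD[OF f that] p by (auto simp: filterlim_iff)
    then show "\<forall>\<^sub>F n in sequentially. c \<le> m + 1 / Suc n - (norm (y n - u))\<^sup>2 / 2"
    proof eventually_elim
      case (elim n)
      then show ?case using y[of n] by simp
    qed
  qed simp
  then have le: "f p \<le> ereal (m - (norm (p - u))\<^sup>2 / 2)"
    by (metis ereal_dense2 ereal_less_eq(3) linorder_not_le)
  then obtain q where q: "f p = ereal q"
    using Gamma0_not_MInf[OF f, of p] by (cases "f p") auto
  show ?thesis
    by (rule that[OF q]) (use m_le le q in force)
qed

text \<open>Fermat's rule at the minimiser \<open>p\<close>: the gradient of the quadratic there is
  \<open>p - u\<close>, so its negative must be a subgradient of \<open>f\<close>.\<close>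

lemma subdifferential_prox_exists:
  fixes f :: "'a::{real_inner, complete_space} \<Rightarrow> ereal"
  assumes f: "f \<in> Gamma0"
  obtains p where "u - p \<in> subdifferential f p"
proof -
  obtain p q where q: "f p = ereal q"
    and min: "\<And>y b. f y = ereal b \<Longrightarrow> q + (norm (p - u))\<^sup>2 / 2 \<le> b + (norm (y - u))\<^sup>2 / 2"
    using Gamma0_prox_exists[OF f] by metis
  have "u - p \<in> subdifferential f p"
  proof (rule subdifferentialI[OF f q])
    fix y b assume b: "f y = ereal b"
    \<comment> \<open>Minimality is tested on the segment from \<open>p\<close> to \<open>y\<close>,
      with \<open>f\<close> bounded there by convexity. Division by \<open>t\<close> leaves an error
      linear in \<open>t\<close>, which vanishes as \<open>t\<close> tends to 0.\<close>
    have step: "q + (u - p) \<bullet> (y - p) \<le> b + t * ((norm (y - p))\<^sup>2 / 2)" if t: "0 < t" "t < 1" for t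
    proof -
      let ?z = "(1 - t) *\<^sub>R p + t *\<^sub>R y"
      have le: "f ?z \<le> ereal ((1 - t) * q + t * b)" by (rule Gamma0_convexD[OF f q b t])
      then obtain a where a: "f ?z = ereal a"
        using Gamma0_not_MInf[OF f, of ?z] by (cases "f ?z") auto
      have "(norm (?z - u))\<^sup>2 = (norm ((p - u) + t *\<^sub>R (y - p)))\<^sup>2" by (simp add: algebra_simps)
      also have "\<dots> = (norm (p - u))\<^sup>2 + 2 * t * ((p - u) \<bullet> (y - p)) + t\<^sup>2 * (norm (y - p))\<^sup>2"
        unfolding power2_norm_eq_inner
        by (simp add: inner_add_left inner_add_right inner_commute power2_eq_square)
      finally have "q \<le> (1 - t) * q + t * b + t * ((p - u) \<bullet> (y - p)) + t\<^sup>2 * (norm (y - p))\<^sup>2 / 2"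
        using min[OF a] le a by (simp add: add_divide_distrib)
      then have "t * (q - (p - u) \<bullet> (y - p)) \<le> t * (b + t * ((norm (y - p))\<^sup>2 / 2))"
        by (simp add: algebra_simps power2_eq_square)
      then have "q - (p - u) \<bullet> (y - p) \<le> b + t * ((norm (y - p))\<^sup>2 / 2)" using t(1) by simp
      moreover have "(u - p) \<bullet> (y - p) = - ((p - u) \<bullet> (y - p))" by (simp add: inner_diff_left)
      ultimately show ?thesis by simp
    qed
    show "q + (u - p) \<bullet> (y - p) \<le> b"
    proof (rule tendsto_lowerbound)
      show "((\<lambda>t. b + t * ((norm (y - p))\<^sup>2 / 2)) \<longlongrightarrow> b) (at_right 0)"
        by (auto intro!: tendsto_eq_intros)
      show "\<forall>\<^sub>F t in at_right 0. q + (u - p) \<bullet> (y - p) \<le> b + t * ((norm (y - p))\<^sup>2 / 2)"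
        using step by (auto simp: eventually_at_right_field intro!: exI[of _ 1])
    qed simp
  qed
  then show ?thesis using that by blast
qed

section \<open>The conjugate and its subdifferential\<close>

lemma fenchel_young: "ereal (x \<bullet> v) - f x \<le> fenchel_conjugate f v"
  unfolding fenchel_conjugate_def by (rule SUP_upper) simp

text \<open>Equality in the Fenchel-Young inequality: a subgradient \<open>v\<close> at
  \<open>x\<close> makes \<open>x\<close> a maximiser in the supremum that defines the
  conjugate.\<close>

lemma fenchel_conjugate_subdifferential:
  assumes f: "f \<in> Gamma0" and v: "v \<in> subdifferential f x" and a: "f x = ereal a"
  shows "fenchel_conjugate f v = ereal (x \<bullet> v - a)"
proof (rule antisym)
  show "fenchel_conjugate f v \<le> ereal (x \<bullet> v - a)"
    unfolding fenchel_conjugate_def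
  proof (rule SUP_least)
    fix y
    show "ereal (y \<bullet> v) - f y \<le> ereal (x \<bullet> v - a)"
      using subdifferentialD[OF v a, of y] Gamma0_not_MInf[OF f, of y]
      by (cases "f y") (auto simp: inner_diff_right inner_commute)
  qed
  show "ereal (x \<bullet> v - a) \<le> fenchel_conjugate f v"
    using fenchel_young[of x v f] a by simp
qed

text \<open>A supremum of affine functions of the dual variable; points with
  \<open>f z = \<infinity>\<close> contribute only the value minus infinity.\<close>

lemma fenchel_conjugate_convex:
  assumes f: "f \<in> Gamma0"
  shows "convex_fun (fenchel_conjugate f)"
  unfolding convex_fun_def
proof (intro allI impI)
  fix x y and t :: real assume t: "0 < t \<and> t < 1"
  let ?g = "fenchel_conjugate f"
  show "?g ((1 - t) *\<^sub>R x + t *\<^sub>R y) \<le> ereal (1 - t) * ?g x + ereal t * ?g y"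
    unfolding fenchel_conjugate_def[of f "(1 - t) *\<^sub>R x + t *\<^sub>R y"]
  proof (rule SUP_least)
    fix z
    show "ereal (z \<bullet> ((1 - t) *\<^sub>R x + t *\<^sub>R y)) - f z \<le> ereal (1 - t) * ?g x + ereal t * ?g y"
    proof (cases "f z")
      case (real r)
      have "ereal (z \<bullet> ((1 - t) *\<^sub>R x + t *\<^sub>R y)) - f z
          = ereal (1 - t) * ereal (z \<bullet> x - r) + ereal t * ereal (z \<bullet> y - r)"
        by (simp add: real inner_add_right algebra_simps)
      also have "\<dots> \<le> ereal (1 - t) * ?g x + ereal t * ?g y"
        using fenchel_young[of z _ f] t real
        by (intro add_mono ereal_mult_left_mono) auto
      finally show ?thesis .
    qed (use Gamma0_not_MInf[OF f, of z] in auto)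
  qed
qed

lemma fenchel_conjugate_lsc:
  assumes f: "f \<in> Gamma0"
  shows "lower_semicontinuous (fenchel_conjugate f)"
  unfolding lower_semicontinuous_def le_Liminf_iff
proof (intro allI impI)
  fix v c assume "c < fenchel_conjugate f v"
  then obtain x where x: "c < ereal (x \<bullet> v) - f x"
    unfolding fenchel_conjugate_def less_SUP_iff by blast
  then obtain r where r: "f x = ereal r"
    using Gamma0_not_MInf[OF f, of x] by (cases "f x") auto
  have "((\<lambda>w. ereal (x \<bullet> w - r)) \<longlongrightarrow> ereal (x \<bullet> v - r)) (nhds v)"
    by (auto intro!: tendsto_intros simp: tendsto_ident_at filterlim_ident)
  then have "\<forall>\<^sub>F w in nhds v. c < ereal (x \<bullet> w - r)"
    by (rule order_tendstoD) (use x r in simp)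
  then show "\<forall>\<^sub>F w in nhds v. c < fenchel_conjugate f w"
  proof eventually_elim
    case (elim w)
    then show ?case using fenchel_young[of x w f] r by simp
  qed
qed

lemma fenchel_conjugate_Gamma0:
  fixes f :: "'a::{real_inner, complete_space} \<Rightarrow> ereal"
  assumes f: "f \<in> Gamma0"
  shows "fenchel_conjugate f \<in> Gamma0"
proof -
  have "fenchel_conjugate f v \<noteq> - \<infinity>" for v
  proof -
    obtain x r where "f x = ereal r" using Gamma0_finite_point[OF f] .
    then show ?thesis using fenchel_young[of x v f] by auto
  qed
  \<comment> \<open>The conjugate is finite at every subgradient of \<open>f\<close>; the proximal
    point of 0 supplies one.\<close>
  moreover obtain p where p: "0 - p \<in> subdifferential f p"
    using subdifferential_prox_exists[OF f] .
  moreover obtain q where "f p = ereal q" using subdifferential_finite[OF f p] .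
  ultimately have "proper_fun (fenchel_conjugate f)"
    unfolding proper_fun_def using fenchel_conjugate_subdifferential[OF f p]
    by (metis PInfty_neq_ereal(1))
  then show ?thesis
    by (simp add: Gamma0_def fenchel_conjugate_convex[OF f] fenchel_conjugate_lsc[OF f])
qed

lemma subdifferential_conjugate_iff:
  fixes f :: "'a::{real_inner, complete_space} \<Rightarrow> ereal"
  assumes f: "f \<in> Gamma0"
  shows "x \<in> subdifferential (fenchel_conjugate f) v \<longleftrightarrow> v \<in> subdifferential f x"
proof
  assume v: "v \<in> subdifferential f x"
  obtain a where a: "f x = ereal a" using subdifferential_finite[OF f v] .
  have "ereal (x \<bullet> v - a) + ereal (x \<bullet> (w - v)) \<le> fenchel_conjugate f w" for w
    using fenchel_young[of x w f] by (simp add: a inner_diff_right)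
  then show "x \<in> subdifferential (fenchel_conjugate f) v"
    by (simp add: subdifferential_def fenchel_conjugate_subdifferential[OF f v a])
next
  assume x: "x \<in> subdifferential (fenchel_conjugate f) v"
  \<comment> \<open>The centre \<open>x + v\<close> is chosen so that \<open>p = x\<close> turns
    this subgradient into \<open>v\<close>.\<close>
  obtain p where p: "x + v - p \<in> subdifferential f p"
    using subdifferential_prox_exists[OF f] .
  obtain q where q: "f p = ereal q" using subdifferential_finite[OF f p] .
  have w: "fenchel_conjugate f (x + v - p) = ereal (p \<bullet> (x + v - p) - q)"
    by (rule fenchel_conjugate_subdifferential[OF f p q])
  obtain s where s: "fenchel_conjugate f v = ereal s"
    using subdifferential_finite[OF fenchel_conjugate_Gamma0[OF f] x] .
  \<comment> \<open>Monotonicity between \<open>v\<close> and \<open>x + v - p\<close>: this is the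
    subgradient inequality of \<open>x\<close>, and Fenchel-Young for \<open>p\<close> at
    \<open>v\<close> gives the other half. The sum bounds the squared norm of \<open>x - p\<close>
    by 0.\<close>
  have "s + x \<bullet> (x + v - p - v) \<le> p \<bullet> (x + v - p) - q" by (rule subdifferentialD[OF x s w])
  moreover have "p \<bullet> v - q \<le> s" using fenchel_young[of p v f] q s by simp
  ultimately have "(x - p) \<bullet> (x - p) \<le> 0"
    by (simp add: inner_simps inner_commute)
  then have "x = p" using inner_ge_zero[of "x - p"] by (metis antisym eq_iff_diff_eq_0 inner_eq_zero_iff)
  then show "v \<in> subdifferential f x" using p by simp
qed

section \<open>Common subgradients along a segment\<close>

lemma subdifferential_segment:
  assumes f: "f \<in> Gamma0" and x: "v \<in> subdifferential f x" "f x = ereal a"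
    and y: "v \<in> subdifferential f y" "f y = ereal b" and t: "0 < t" "t < 1"
  shows "f ((1 - t) *\<^sub>R x + t *\<^sub>R y) = ereal ((1 - t) * a + t * b)"
    and "v \<in> subdifferential f ((1 - t) *\<^sub>R x + t *\<^sub>R y)"
proof -
  let ?z = "(1 - t) *\<^sub>R x + t *\<^sub>R y"
  have le: "f ?z \<le> ereal ((1 - t) * a + t * b)" by (rule Gamma0_convexD[OF f x(2) y(2) t])
  then obtain c where c: "f ?z = ereal c"
    using Gamma0_not_MInf[OF f, of ?z] by (cases "f ?z") auto
  \<comment> \<open>The inequalities of the same \<open>v\<close> at both ends bound
    \<open>b - a\<close> from opposite sides.\<close>
  have ba: "b = a + v \<bullet> (y - x)"
    using subdifferentialD[OF x y(2)] subdifferentialD[OF y x(2)]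
    by (simp add: inner_diff_right)
  have z: "v \<bullet> (?z - x) = t * (v \<bullet> (y - x))"
    by (simp add: inner_simps algebra_simps)
  \<comment> \<open>The subgradient at \<open>x\<close> bounds \<open>c\<close> from below,
    convexity from above, by the same number.\<close>
  have ca: "c = a + t * (v \<bullet> (y - x))"
    using subdifferentialD[OF x c] le c z by (simp add: ba algebra_simps)
  have "(1 - t) * a + t * b = a + t * (v \<bullet> (y - x))"
    unfolding ba by (simp add: left_diff_distrib distrib_left)
  with ca show "f ?z = ereal ((1 - t) * a + t * b)" using c by simp
  show "v \<in> subdifferential f ?z"
  proof (rule subdifferentialI[OF f c])
    fix u r assume "f u = ereal r"
    then have "a + v \<bullet> (u - x) \<le> r" by (rule subdifferentialD[OF x])
    then show "c + v \<bullet> (u - ?z) \<le> r"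
      using z ca by (simp add: inner_diff_right)
  qed
qed

text \<open>Subtracting the linear form of \<open>v\<close> from \<open>f\<close> gives a function
  minimal at the inner point. By the last hypothesis the weighted mean of its end values does not
  exceed this minimum, so both ends are minimisers too.\<close>

lemma subdifferential_endpoints:
  assumes f: "f \<in> Gamma0" and x: "f x = ereal a" and y: "f y = ereal b" and t: "0 < t" "t < 1"
    and v: "v \<in> subdifferential f ((1 - t) *\<^sub>R x + t *\<^sub>R y)"
    and z: "f ((1 - t) *\<^sub>R x + t *\<^sub>R y) = ereal c" and c: "(1 - t) * a + t * b \<le> c"
  shows "v \<in> subdifferential f x" "v \<in> subdifferential f y"
proof -
  let ?z = "(1 - t) *\<^sub>R x + t *\<^sub>R y"
  have vz: "v \<bullet> ?z = (1 - t) * (v \<bullet> x) + t * (v \<bullet> y)" by (simp add: inner_simps)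
  have "c - v \<bullet> ?z \<le> a - v \<bullet> x" "c - v \<bullet> ?z \<le> b - v \<bullet> y"
    using subdifferentialD[OF v z x] subdifferentialD[OF v z y] by (simp_all add: inner_diff_right)
  moreover have "(1 - t) * (a - v \<bullet> x) + t * (b - v \<bullet> y) \<le> c - v \<bullet> ?z"
    using c vz by (simp add: algebra_simps)
  \<comment> \<open>Here \<open>M\<close> stands for the minimum and \<open>P\<close>,
    \<open>Q\<close> for the two end values. Both weights are positive, so neither excess over
    \<open>M\<close> can be compensated by the other.\<close>
  moreover have "P \<le> M \<and> Q \<le> M"
    if "M \<le> P" "M \<le> Q" "(1 - t) * P + t * Q \<le> M" for P Q M :: real
  proof -
    have "(1 - t) * (P - M) + t * (Q - M) \<le> 0" using that(3) by (simp add: algebra_simps)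
    moreover have "0 \<le> (1 - t) * (P - M)" "0 \<le> t * (Q - M)" using that t by auto
    ultimately have "(1 - t) * (P - M) \<le> 0" "t * (Q - M) \<le> 0" by linarith+
    then show ?thesis using t by (auto simp: mult_le_0_iff)
  qed
  ultimately have eq: "a - v \<bullet> x \<le> c - v \<bullet> ?z" "b - v \<bullet> y \<le> c - v \<bullet> ?z" by blast+
  show "v \<in> subdifferential f x"
  proof (rule subdifferentialI[OF f x])
    fix u r assume "f u = ereal r"
    from subdifferentialD[OF v z this] show "a + v \<bullet> (u - x) \<le> r"
      using eq by (simp add: inner_diff_right)
  qed
  show "v \<in> subdifferential f y"
  proof (rule subdifferentialI[OF f y])
    fix u r assume "f u = ereal r"
    from subdifferentialD[OF v z this] show "b + v \<bullet> (u - y) \<le> r"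
      using eq by (simp add: inner_diff_right)
  qed
qed

section \<open>The equivalence\<close>

theorem theorem7p3:
  fixes f :: "'a::{real_inner, complete_space} \<Rightarrow> ereal"
  assumes "f \<in> Gamma0"
  shows "almost_strictly_convex f \<longleftrightarrow> almost_differentiable (fenchel_conjugate f)"
proof
  note f = assms
  assume asc: "almost_strictly_convex f"
  have "x = y" if "x \<in> subdifferential (fenchel_conjugate f) v"
    "y \<in> subdifferential (fenchel_conjugate f) v" for x y v
  proof (rule ccontr)
    assume "x \<noteq> y"
    have v: "v \<in> subdifferential f x" "v \<in> subdifferential f y"
      using that subdifferential_conjugate_iff[OF f] by auto
    obtain a b where ab: "f x = ereal a" "f y = ereal b"
      using subdifferential_finite[OF f] v by metis
    note seg = subdifferential_segment[OF f v(1) ab(1) v(2) ab(2)]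
    \<comment> \<open>Almost strict convexity speaks only of segments inside the domain of the
      subdifferential; the common subgradient \<open>v\<close> puts this one there. Since
      \<open>seg\<close> covers only inner points, the ends are treated separately.\<close>
    have "closed_segment x y \<subseteq> dom_subdifferential f"
    proof
      fix z assume "z \<in> closed_segment x y"
      then have "z = x \<or> z = y \<or> z \<in> open_segment x y" by (auto simp: open_segment_def)
      then have "v \<in> subdifferential f z" using v seg(2) by (auto simp: in_segment)
      then show "z \<in> dom_subdifferential f" by (auto simp: dom_subdifferential_def)
    qed
    then have "strictly_convex_fun_on (closed_segment x y) f"
      using asc by (auto simp: almost_strictly_convex_def)
    \<comment> \<open>Strictness at the midpoint contradicts the affine identity in
      \<open>seg\<close>.\<close>
    then have "f ((1 - 1/2) *\<^sub>R x + (1/2) *\<^sub>R y) < ereal (1 - 1/2) * f x + ereal (1/2) * f y"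
      unfolding strictly_convex_fun_on_def using \<open>x \<noteq> y\<close>
      by (elim ballE[where x = x] ballE[where x = y] allE[where x = "1/2"]) auto
    then show False using seg(1)[of "1/2"] ab by simp
  qed
  then show "almost_differentiable (fenchel_conjugate f)"
    unfolding almost_differentiable_def using fenchel_conjugate_Gamma0[OF f] by blast
next
  note f = assms
  assume ad: "almost_differentiable (fenchel_conjugate f)"
  have "strictly_convex_fun_on (closed_segment a b) f"
    if sub: "closed_segment a b \<subseteq> dom_subdifferential f" for a b
    unfolding strictly_convex_fun_on_def
  proof (intro ballI allI impI)
    fix x y and t :: real
    assume x: "x \<in> closed_segment a b" and y: "y \<in> closed_segment a b"
      and "x \<noteq> y \<and> 0 < t \<and> t < 1"
    then have xy: "x \<noteq> y" and t: "0 < t" "t < 1" by auto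
    let ?z = "(1 - t) *\<^sub>R x + t *\<^sub>R y"
    \<comment> \<open>This is where the segment hypothesis yields a subgradient at the inner
      point.\<close>
    have "?z \<in> closed_segment a b"
      using convexD_alt[OF convex_closed_segment x y] t by auto
    then obtain v where v: "v \<in> subdifferential f ?z"
      using sub by (auto simp: dom_subdifferential_def)
    have fin: "\<exists>r. f u = ereal r" if "u \<in> dom_subdifferential f" for u
      using that subdifferential_finite[OF f] unfolding dom_subdifferential_def by blast
    obtain c where c: "f ?z = ereal c" using subdifferential_finite[OF f v] .
    obtain p q where pq: "f x = ereal p" "f y = ereal q" using fin x y sub by blast
    \<comment> \<open>If strictness failed, \<open>v\<close> would be a subgradient at both ends,
      and the conjugate would have the distinct subgradients \<open>x\<close> and \<open>y\<close>
      at \<open>v\<close>.\<close>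
    have "c < (1 - t) * p + t * q"
    proof (rule ccontr)
      assume "\<not> c < (1 - t) * p + t * q"
      then have "v \<in> subdifferential f x" "v \<in> subdifferential f y"
        using subdifferential_endpoints[OF f pq t v c] by auto
      then have "x \<in> subdifferential (fenchel_conjugate f) v"
          "y \<in> subdifferential (fenchel_conjugate f) v"
        using subdifferential_conjugate_iff[OF f] by auto
      with ad xy show False
        unfolding almost_differentiable_def by (metis empty_iff singletonD)
    qed
    then show "f ?z < ereal (1 - t) * f x + ereal t * f y" by (simp add: c pq)
  qed
  then show "almost_strictly_convex f" using f by (simp add: almost_strictly_convex_def)
qed

end
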